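(* Let $G$ be a connected simple graph. Then $\sigma^-(G)=1$ if and only if $G$ has a cut-edge $e$ such that the two components of $G-e$ have orders differing by at most one.
   Context: For a graph $G$ with $N$ vertices and a bijection $f:V(G)\to\{1,\dots,N\}$, call an edge $uv$ negative under $f$ if $f(u)$ and $f(v)$ have opposite parity. The rna number $\sigma^-(G)$ is the minimum, over all such bijections $f$, of the number of negative edges under $f$. *)

theory Defs
  imports Main
begin

text \<open>
  A graph is given by its vertex set \<open>V\<close> and its set \<open>E\<close> of edges, an edge \<open>uv\<close> being
  the two-element set \<open>{u, v}\<close>.
\<close>

definition simple_graph :: "'a set \<Rightarrow> 'a set set \<Rightarrow> bool" where
  "simple_graph V E \<longleftrightarrow>
     finite V \<and> (\<forall>e\<in>E. \<exists>u v. u \<in> V \<and> v \<in> V \<and> u \<noteq> v \<and> e = {u, v})"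

definition reachable :: "'a set set \<Rightarrow> 'a \<Rightarrow> 'a \<Rightarrow> bool" where
  "reachable E u v \<longleftrightarrow> (u, v) \<in> {(x, y). {x, y} \<in> E}\<^sup>*"

definition connected_graph :: "'a set \<Rightarrow> 'a set set \<Rightarrow> bool" where
  "connected_graph V E \<longleftrightarrow> V \<noteq> {} \<and> (\<forall>u\<in>V. \<forall>v\<in>V. reachable E u v)"

text \<open>Components are represented by their vertex sets, so the order of \<open>C\<close> is \<open>card C\<close>.\<close>

definition components :: "'a set \<Rightarrow> 'a set set \<Rightarrow> 'a set set" where
  "components V E = {{v \<in> V. reachable E u v} | u. u \<in> V}"

definition cut_edge :: "'a set \<Rightarrow> 'a set set \<Rightarrow> 'a set \<Rightarrow> bool" where
  "cut_edge V E e \<longleftrightarrow> e \<in> E \<and> card (components V E) < card (components V (E - {e}))"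

definition negative_edges :: "'a set set \<Rightarrow> ('a \<Rightarrow> nat) \<Rightarrow> 'a set set" where
  "negative_edges E f = {e \<in> E. \<exists>u v. e = {u, v} \<and> even (f u) \<noteq> even (f v)}"

text \<open>
  For a simple graph the set below is nonempty and, being bounded by \<open>card E\<close>, finite,
  so \<open>Min\<close> is the true minimum.
\<close>

definition rna_number :: "'a set \<Rightarrow> 'a set set \<Rightarrow> nat" where
  "rna_number V E = Min {card (negative_edges E f) | f. bij_betw f V {1..card V}}"

end

theory Submission
  imports Defs
begin

text \<open>
  A labelling splits the vertices into odd and even ones, and the two classes have sizes
  \<open>\<lceil>N/2\<rceil>\<close> and \<open>\<lfloor>N/2\<rfloor>\<close>; conversely every bipartition with these sizes arises from a labelling.
  The negative edges are those joining the two classes, and connectedness forces at least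
  one of them once \<open>N \<ge> 2\<close>. If \<open>e\<close> is the only one, no component of \<open>G - e\<close> meets both classes,
  while every vertex is still joined to an end of \<open>e\<close>; so the classes are the components.
\<close>

lemma reachable_refl: "reachable E x x"
  by (simp add: reachable_def)

lemma reachable_trans: "reachable E x y \<Longrightarrow> reachable E y z \<Longrightarrow> reachable E x z"
  unfolding reachable_def by (rule rtrancl_trans)

lemma reachable_edge: "{x, y} \<in> E \<Longrightarrow> reachable E x y"
  by (auto simp: reachable_def)

lemma reachable_sym: "reachable E x y \<Longrightarrow> reachable E y x"
proof -
  have "sym {(x, y). {x, y} \<in> E}"
    by (auto intro!: symI simp: insert_commute)
  then show "reachable E x y \<Longrightarrow> reachable E y x"
    unfolding reachable_def by (meson sym_rtrancl symD)
qed

lemma reachable_invariant: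
  assumes "reachable E x y" and "\<And>a b. {a, b} \<in> E \<Longrightarrow> P a \<Longrightarrow> P b" and "P x"
  shows "P y"
  using assms(1) unfolding reachable_def
  by (induction rule: rtrancl_induct) (use assms in auto)

lemma components_connected:
  assumes "connected_graph V E"
  shows "components V E = {V}"
  using assms unfolding components_def connected_graph_def by auto

lemma components_disjoint:
  assumes "A \<in> components V E" "B \<in> components V E" "A \<noteq> B"
  shows "A \<inter> B = {}"
proof (rule ccontr)
  assume "A \<inter> B \<noteq> {}"
  then obtain z where z: "z \<in> A" "z \<in> B" by blast
  obtain a b where ab: "A = {v \<in> V. reachable E a v}" "B = {v \<in> V. reachable E b v}"
    using assms(1,2) unfolding components_def by blast
  have "reachable E a b" "reachable E b a"
    using z ab reachable_sym reachable_trans by (metis (no_types, lifting) mem_Collect_eq)+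
  then have "A = B" unfolding ab by (auto intro: reachable_trans)
  with assms(3) show False by simp
qed

lemma Union_components: "\<Union> (components V E) = V"
  unfolding components_def by (auto intro: reachable_refl)

lemma edge_in_component:
  assumes "C \<in> components V E" "{x, y} \<in> E" "x \<in> C" "y \<in> V"
  shows "y \<in> C"
proof -
  obtain a where a: "C = {v \<in> V. reachable E a v}"
    using assms(1) unfolding components_def by blast
  then show ?thesis
    using assms by (auto intro: reachable_trans reachable_edge)
qed

lemma simple_graph_edge_subset: "simple_graph V E \<Longrightarrow> e \<in> E \<Longrightarrow> e \<subseteq> V"
  unfolding simple_graph_def by fastforce

lemma simple_graph_finite_edges: "simple_graph V E \<Longrightarrow> finite E"
  by (meson Pow_iff finite_Pow_iff rev_finite_subset simple_graph_def simple_graph_edge_subset subsetI)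

lemma reachable_delete_edge:
  assumes "reachable E u x"
  shows "reachable (E - {{u, v}}) u x \<or> reachable (E - {{u, v}}) v x"
proof (rule reachable_invariant[OF assms])
  let ?R = "reachable (E - {{u, v}})"
  show "?R u u \<or> ?R v u" by (simp add: reachable_refl)
  fix a b assume ab: "{a, b} \<in> E" "?R u a \<or> ?R v a"
  show "?R u b \<or> ?R v b"
  proof (cases "{a, b} = {u, v}")
    case True
    then show ?thesis by (auto simp: doubleton_eq_iff reachable_refl)
  next
    case False
    then have "?R a b" using ab by (auto intro: reachable_edge)
    then show ?thesis using ab reachable_trans by metis
  qed
qed

lemma negative_edge_doubleton_iff:
  "{x, y} \<in> negative_edges E f \<longleftrightarrow> {x, y} \<in> E \<and> even (f x) \<noteq> even (f y)"
  unfolding negative_edges_def by (auto simp: doubleton_eq_iff)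

lemma card_odd_even:
  "card {i \<in> {1..n}. odd i} = (n + 1) div 2 \<and> card {i \<in> {1..n}. even i} = n div (2::nat)"
proof (induction n)
  case (Suc n)
  have "{1..Suc n} = insert (Suc n) {1..n}" by auto
  then have "{i \<in> {1..Suc n}. odd i} =
      (if odd (Suc n) then insert (Suc n) {i \<in> {1..n}. odd i} else {i \<in> {1..n}. odd i})"
    and "{i \<in> {1..Suc n}. even i} =
      (if even (Suc n) then insert (Suc n) {i \<in> {1..n}. even i} else {i \<in> {1..n}. even i})"
    by auto
  with Suc show ?case by (auto elim!: evenE oddE)
qed simp

lemma labelling_parity_classes:
  assumes f: "bij_betw f V {1..card V}"
  shows "card {x \<in> V. odd (f x)} = (card V + 1) div 2"
    and "card {x \<in> V. even (f x)} = card V div 2"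
proof -
  have inj: "inj_on f V" and im: "f ` V = {1..card V}"
    using f by (auto simp: bij_betw_def)
  have transfer: "card {x \<in> V. P (f x)} = card {i \<in> {1..card V}. P i}" for P
  proof -
    have "f ` {x \<in> V. P (f x)} = {i \<in> {1..card V}. P i}"
      unfolding im[symmetric] by auto
    moreover have "inj_on f {x \<in> V. P (f x)}"
      using inj by (rule inj_on_subset) auto
    ultimately show ?thesis by (metis card_image)
  qed
  show "card {x \<in> V. odd (f x)} = (card V + 1) div 2"
    and "card {x \<in> V. even (f x)} = card V div 2"
    using card_odd_even[of "card V"] transfer[of odd] transfer[of even] by simp_all
qed

lemma labelling_of_bipartition:
  assumes "finite A" "finite B" "A \<inter> B = {}" "card B \<le> card A" "card A \<le> card B + 1"
  obtains f where "bij_betw f (A \<union> B) {1..card (A \<union> B)}"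
    and "\<And>x. x \<in> A \<Longrightarrow> odd (f x)" and "\<And>x. x \<in> B \<Longrightarrow> even (f x)"
proof -
  let ?n = "card (A \<union> B)"
  let ?O = "{i \<in> {1..?n}. odd i}" and ?F = "{i \<in> {1..?n}. even i}"
  have n: "?n = card A + card B" using assms by (simp add: card_Un_disjoint)
  have "card A = card ?O" "card B = card ?F"
    unfolding card_odd_even[THEN conjunct1] card_odd_even[THEN conjunct2]
    using n assms(4,5) by presburger+
  then obtain g h where g: "bij_betw g A ?O" and h: "bij_betw h B ?F"
    using assms(1,2) finite_same_card_bij[of A ?O] finite_same_card_bij[of B ?F] by auto
  define f where "f x = (if x \<in> A then g x else h x)" for x
  have fA: "bij_betw f A ?O"
    using g by (rule bij_betw_cong[THEN iffD1, rotated]) (simp add: f_def)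
  have fB: "bij_betw f B ?F"
    using h by (rule bij_betw_cong[THEN iffD1, rotated]) (use assms(3) in \<open>auto simp: f_def\<close>)
  have "bij_betw f (A \<union> B) (?O \<union> ?F)"
    using fA fB by (rule bij_betw_combine) auto
  moreover have "?O \<union> ?F = {1..?n}" by auto
  ultimately have "bij_betw f (A \<union> B) {1..?n}" by simp
  then show thesis
    by (rule that) (use bij_betwE[OF fA] bij_betwE[OF fB] in auto)
qed

lemma negative_edges_nonempty:
  assumes "connected_graph V E" "2 \<le> card V" "bij_betw f V {1..card V}"
  shows "negative_edges E f \<noteq> {}"
proof
  assume none: "negative_edges E f = {}"
  have "1 \<in> f ` V" "2 \<in> f ` V"
    using assms(2,3) by (auto simp: bij_betw_def)
  then obtain x y where xy: "x \<in> V" "y \<in> V" "f x = 1" "f y = 2" by auto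
  then have "reachable E x y" using assms(1) by (simp add: connected_graph_def)
  then have "odd (f y)"
    by (rule reachable_invariant)
      (use none negative_edge_doubleton_iff[of _ _ E f] xy in auto)
  with xy show False by simp
qed

lemma rna_number_attained:
  assumes "simple_graph V E"
  obtains f where "bij_betw f V {1..card V}" "card (negative_edges E f) = rna_number V E"
    and "\<And>g. bij_betw g V {1..card V} \<Longrightarrow> rna_number V E \<le> card (negative_edges E g)"
proof -
  let ?S = "{card (negative_edges E f) | f. bij_betw f V {1..card V}}"
  have "?S \<subseteq> {..card E}"
    using simple_graph_finite_edges[OF assms]
    by (auto simp: negative_edges_def intro!: card_mono)
  then have fin: "finite ?S" by (rule finite_subset) simp
  have "finite V" using assms by (simp add: simple_graph_def)
  then obtain f where "bij_betw f V {1..card V}"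
    using finite_same_card_bij[of V "{1..card V}"] by auto
  then have "?S \<noteq> {}" by blast
  with fin have "rna_number V E \<in> ?S" unfolding rna_number_def by (rule Min_in)
  then obtain f where "bij_betw f V {1..card V}" "card (negative_edges E f) = rna_number V E"
    by auto
  then show thesis
    by (rule that) (use fin in \<open>auto simp: rna_number_def intro!: Min_le\<close>)
qed

lemma components_delete_unique_negative_edge:
  assumes simple: "simple_graph V E" and conn: "connected_graph V E"
    and neg: "negative_edges E f = {{u, v}}" and "odd (f u)" "even (f v)"
  shows "components V (E - {{u, v}}) = {{x \<in> V. odd (f x)}, {x \<in> V. even (f x)}}"
proof -
  let ?R = "reachable (E - {{u, v}})"
  have "{u, v} \<in> E" using neg by (auto simp: negative_edges_def)
  then have uv: "u \<in> V" "v \<in> V" using simple_graph_edge_subset[OF simple] by auto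
  have parity: "even (f y) = even (f x)" if "?R x y" for x y
    using that
  proof (rule reachable_invariant)
    fix a b assume "{a, b} \<in> E - {{u, v}}" "even (f a) = even (f x)"
    then show "even (f b) = even (f x)"
      using neg negative_edge_doubleton_iff[of a b E f] by auto
  qed simp
  have cover: "?R u x \<or> ?R v x" if "x \<in> V" for x
    using conn uv(1) that reachable_delete_edge unfolding connected_graph_def by metis
  have cls: "{y \<in> V. ?R x y} = {y \<in> V. even (f y) = even (f x)}" if "x \<in> V" for x
  proof -
    have "?R x y" if "y \<in> V" "even (f y) = even (f x)" for y
    proof (cases "odd (f x)")
      case True
      then have "?R u x" "?R u y"
        using cover \<open>x \<in> V\<close> that parity assms(5) by metis+
      then show ?thesis using reachable_sym reachable_trans by metis
    next
      case False
      then have "?R v x" "?R v y"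
        using cover \<open>x \<in> V\<close> that parity assms(4) by metis+
      then show ?thesis using reachable_sym reachable_trans by metis
    qed
    then show ?thesis using parity by blast
  qed
  have "components V (E - {{u, v}}) = (\<lambda>x. {y \<in> V. even (f y) = even (f x)}) ` V"
    unfolding components_def using cls by auto
  also have "\<dots> = {{x \<in> V. odd (f x)}, {x \<in> V. even (f x)}}"
  proof (rule antisym)
    have "{x \<in> V. odd (f x)} = {y \<in> V. even (f y) = even (f u)}"
      and "{x \<in> V. even (f x)} = {y \<in> V. even (f y) = even (f v)}"
      using assms(4,5) by auto
    then show "{{x \<in> V. odd (f x)}, {x \<in> V. even (f x)}} \<subseteq>
        (\<lambda>x. {y \<in> V. even (f y) = even (f x)}) ` V"
      using uv by blast
    show "(\<lambda>x. {y \<in> V. even (f y) = even (f x)}) ` V \<subseteq>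
        {{x \<in> V. odd (f x)}, {x \<in> V. even (f x)}}"
    proof
      fix C assume "C \<in> (\<lambda>x. {y \<in> V. even (f y) = even (f x)}) ` V"
      then obtain x where "C = {y \<in> V. even (f y) = even (f x)}" by blast
      then show "C \<in> {{x \<in> V. odd (f x)}, {x \<in> V. even (f x)}}"
        by (cases "even (f x)") auto
    qed
  qed
  finally show ?thesis .
qed

lemma rna_number_eq_1_if_balanced_components:
  assumes simple: "simple_graph V E" and conn: "connected_graph V E"
    and comps: "components V (E - {e}) = {A, B}" and "A \<noteq> B"
    and "card B \<le> card A" "card A \<le> card B + 1"
  shows "rna_number V E = 1"
proof -
  have V: "A \<union> B = V" using Union_components[of V "E - {e}"] comps by simp
  have fin: "finite V" using simple by (simp add: simple_graph_def)
  have finAB: "finite A" "finite B" using V fin by auto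
  have disj: "A \<inter> B = {}"
    using components_disjoint[of A V "E - {e}" B] comps \<open>A \<noteq> B\<close> by simp
  have "A \<noteq> {}" "B \<noteq> {}"
    using comps reachable_refl unfolding components_def by (smt (verit) empty_iff insertI1 insert_commute mem_Collect_eq)+
  then have "card A \<ge> 1" "card B \<ge> 1" using finAB by (simp_all add: Suc_le_eq card_gt_0_iff)
  then have two: "2 \<le> card V"
    unfolding V[symmetric] card_Un_disjoint[OF finAB disj] by linarith
  obtain g where g: "bij_betw g V {1..card V}"
    and gA: "\<And>x. x \<in> A \<Longrightarrow> odd (g x)" and gB: "\<And>x. x \<in> B \<Longrightarrow> even (g x)"
    using labelling_of_bipartition[OF finAB disj assms(5,6)] unfolding V by blast
  have "negative_edges E g \<subseteq> {e}"
  proof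
    fix d assume d: "d \<in> negative_edges E g"
    then obtain x y where xy: "d = {x, y}" "even (g x) \<noteq> even (g y)" "d \<in> E"
      unfolding negative_edges_def by blast
    then have "x \<in> V" "y \<in> V" using simple_graph_edge_subset[OF simple, of d] by auto
    show "d \<in> {e}"
    proof (rule ccontr)
      assume "d \<notin> {e}"
      then have edge: "{x, y} \<in> E - {e}" using xy by auto
      have "x \<in> A \<Longrightarrow> y \<in> A" "x \<in> B \<Longrightarrow> y \<in> B"
        using edge_in_component[OF _ edge _ \<open>y \<in> V\<close>] comps by auto
      then show False using \<open>x \<in> V\<close> V gA gB xy(2) by auto
    qed
  qed
  then have "card (negative_edges E g) \<le> 1"
    using card_mono[of "{e}"] by fastforce
  obtain f where f: "bij_betw f V {1..card V}" "card (negative_edges E f) = rna_number V E"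
    and least: "rna_number V E \<le> card (negative_edges E g)"
    using rna_number_attained[OF simple] g by metis
  have "negative_edges E f \<noteq> {}" using negative_edges_nonempty[OF conn two f(1)] .
  moreover have "finite (negative_edges E f)"
    using simple_graph_finite_edges[OF simple] by (simp add: negative_edges_def)
  ultimately have "rna_number V E > 0" using f(2) by (metis card_gt_0_iff)
  then show ?thesis using least \<open>card (negative_edges E g) \<le> 1\<close> by linarith
qed

theorem theorem14:
  fixes V :: "'a set" and E :: "'a set set"
  assumes "simple_graph V E"
    and "connected_graph V E"
  shows "rna_number V E = 1 \<longleftrightarrow>
    (\<exists>e. cut_edge V E e \<and>
      (\<exists>A B. A \<noteq> B \<and> components V (E - {e}) = {A, B} \<and>
        \<bar>int (card A) - int (card B)\<bar> \<le> 1))"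
proof
  assume "rna_number V E = 1"
  then obtain f where f: "bij_betw f V {1..card V}" "card (negative_edges E f) = 1"
    using rna_number_attained[OF assms(1)] by metis
  then obtain e where e: "negative_edges E f = {e}" by (auto simp: card_1_singleton_iff)
  then obtain u v where uv: "e = {u, v}" "odd (f u)" "even (f v)" and "e \<in> E"
    unfolding negative_edges_def by (smt (verit) insert_commute insertI1 mem_Collect_eq)
  let ?A = "{x \<in> V. odd (f x)}" and ?B = "{x \<in> V. even (f x)}"
  have comps: "components V (E - {e}) = {?A, ?B}"
    using components_delete_unique_negative_edge[OF assms e[unfolded uv(1)] uv(2,3)]
    by (simp only: uv(1))
  have "u \<in> ?A" "u \<notin> ?B"
    using uv simple_graph_edge_subset[OF assms(1) \<open>e \<in> E\<close>] by auto
  then have "?A \<noteq> ?B" by blast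
  then have "cut_edge V E e"
    using \<open>e \<in> E\<close> by (simp add: cut_edge_def comps components_connected[OF assms(2)])
  moreover have "\<bar>int (card ?A) - int (card ?B)\<bar> \<le> 1"
    unfolding labelling_parity_classes[OF f(1)] by presburger
  ultimately show "\<exists>e. cut_edge V E e \<and>
      (\<exists>A B. A \<noteq> B \<and> components V (E - {e}) = {A, B} \<and>
        \<bar>int (card A) - int (card B)\<bar> \<le> 1)"
    using comps \<open>?A \<noteq> ?B\<close> by (intro exI[of _ e] exI[of _ ?A] exI[of _ ?B] conjI)
next
  assume "\<exists>e. cut_edge V E e \<and>
      (\<exists>A B. A \<noteq> B \<and> components V (E - {e}) = {A, B} \<and>
        \<bar>int (card A) - int (card B)\<bar> \<le> 1)"
  then obtain e A B where AB: "A \<noteq> B" "components V (E - {e}) = {A, B}"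
    "\<bar>int (card A) - int (card B)\<bar> \<le> 1" by (elim exE conjE) (rule that)
  show "rna_number V E = 1"
  proof (cases "card B \<le> card A")
    case True
    with AB(3) show ?thesis
      by (intro rna_number_eq_1_if_balanced_components[OF assms AB(2,1)]) linarith+
  next
    case False
    have "components V (E - {e}) = {B, A}" using AB(2) by (simp add: insert_commute)
    from rna_number_eq_1_if_balanced_components[OF assms this AB(1)[symmetric]] False AB(3)
    show ?thesis by linarith
  qed
qed

end
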